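(* Let $f:\Omega\to\mathbb{R}$ be a Lipschitz function with Lipschitz coefficient $\|f\|_{\mathrm{Lip}}$, let $S_{\max}:=\sup_{x\in\Omega}\frac{\sigma^2(x)}{n(x)}$, and $$D_{\max}:=2\|f\|_{\mathrm{Lip}}^2\,S_{\max}\cdot\sum_{i=0}^{\infty}\exp\left(\tfrac23(1-\kappa_i)\|f\|_{\mathrm{Lip}}\right)(1-\kappa_i)^2 .$$ Let $t_{\max}:=D_{\max}/(6\sigma_\infty)$ and $X\sim\pi$. Then for $0\le t\le t_{\max}$, $$\mathbb{P}_{\pi}(|f(X)-\mathbb{E}_{\pi}(f)|\ge t)\le 2\exp\left(-\frac{t^2}{D_{\max}}\right),$$ while for $t>t_{\max}$, $$\mathbb{P}_{\pi}(|f(X)-\mathbb{E}_{\pi}(f)|\ge t)\le 2\exp\left(-\frac{t_{\max}^2}{D_{\max}}-\frac{t-t_{\max}}{3\sigma_\infty}\right).$$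
   Context: $(\Omega,d)$ is a Polish metric space and $P(x,\mathrm{d}y)$ is a Markov kernel on $\Omega$, measurable in $x$, with stationary distribution $\pi$; $P_x=P(x,\cdot)$, and $W_1(\delta_x,P_x)<\infty$ for every $x$. $P^k_x$ is the $k$-step kernel, $P^0_x=\delta_x$. $W_1(\mu_1,\mu_2)=\inf\mathbb{E}(d(X,Y))$ over all couplings $(X,Y)$ of $\mu_1,\mu_2$. No reversibility is assumed. Multi-step coarse Ricci curvature: $\kappa_k(x,y)=1-W_1(P^k_x,P^k_y)/d(x,y)$ for $x\ne y$, $\kappa_k(x,x)=1$, $\kappa_k=\inf_{x,y\in\Omega}\kappa_k(x,y)$. Coarse diffusion constant at $x$: $\sigma(x)=\left(\frac12\iint d(y,z)^2\,\mathrm{d}P_x(y)\,\mathrm{d}P_x(z)\right)^{1/2}$. Local dimension at $x$: $n(x)=\sigma(x)^2/\sup\{\mathrm{Var}_{P_x}f : f:\mathrm{Supp}\,P_x\to\mathbb{R}\ 1\text{-Lipschitz}\}$; thus $\sigma^2(x)/n(x)=\sup\{\mathrm{Var}_{P_x}f: f\ 1\text{-Lipschitz on }\mathrm{Supp}\,P_x\}$, which is also the reading when $\sigma(x)=0$. Granularity: $\sigma_\infty=\sup_{x\in\Omega}\frac12\,\mathrm{diam}\,\mathrm{Supp}\,P_x$. It is understood that $0<\sigma_\infty<\infty$ and $0<D_{\max}<\infty$, so that the expressions are meaningful. *)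

theory Defs
  imports "HOL-Probability.Probability"
begin

text \<open>
  Suprema, Wasserstein distances and squared diffusion constants may a priori be infinite, so these
  quantities take values in \<^typ>\<open>ennreal\<close>; the curvature, which may be minus infinity, takes values
  in \<^typ>\<open>ereal\<close>. This avoids the default values of real suprema and Bochner integrals.
\<close>

definition ennreal_sqrt :: "ennreal \<Rightarrow> ennreal" where
  "ennreal_sqrt a = (if a = \<top> then \<top> else ennreal (sqrt (enn2real a)))"

definition ereal_exp :: "ereal \<Rightarrow> ennreal" where
  "ereal_exp a = (case a of ereal r \<Rightarrow> ennreal (exp r) | PInfty \<Rightarrow> \<top> | MInfty \<Rightarrow> 0)"


subsection \<open>Wasserstein distance\<close>

definition couplings :: "'a measure \<Rightarrow> 'a measure \<Rightarrow> ('a \<times> 'a) measure set" where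
  "couplings \<mu> \<nu> = {Q. prob_space Q \<and> sets Q = sets (\<mu> \<Otimes>\<^sub>M \<nu>)
      \<and> distr Q \<mu> fst = \<mu> \<and> distr Q \<nu> snd = \<nu>}"

definition W1 :: "'a::metric_space measure \<Rightarrow> 'a measure \<Rightarrow> ennreal" where
  "W1 \<mu> \<nu> = (INF Q\<in>couplings \<mu> \<nu>. \<integral>\<^sup>+ z. ennreal (dist (fst z) (snd z)) \<partial>Q)"


subsection \<open>Markov kernels and multi-step coarse Ricci curvature\<close>

definition markov_kernel :: "('a::topological_space \<Rightarrow> 'a measure) \<Rightarrow> bool" where
  "markov_kernel P \<longleftrightarrow> P \<in> borel \<rightarrow>\<^sub>M prob_algebra borel"

definition stationary :: "('a::topological_space \<Rightarrow> 'a measure) \<Rightarrow> 'a measure \<Rightarrow> bool" where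
  "stationary P \<pi> \<longleftrightarrow> \<pi> \<in> space (prob_algebra borel) \<and> \<pi> \<bind> P = \<pi>"

primrec kernel_pow :: "('a::topological_space \<Rightarrow> 'a measure) \<Rightarrow> nat \<Rightarrow> 'a \<Rightarrow> 'a measure" where
  "kernel_pow P 0 x = return borel x"
| "kernel_pow P (Suc k) x = kernel_pow P k x \<bind> P"

definition ricci_at :: "('a::metric_space \<Rightarrow> 'a measure) \<Rightarrow> nat \<Rightarrow> 'a \<Rightarrow> 'a \<Rightarrow> ereal" where
  "ricci_at P k x y =
     (if x = y then 1
      else 1 - enn2ereal (W1 (kernel_pow P k x) (kernel_pow P k y)) / ereal (dist x y))"

definition ricci :: "('a::metric_space \<Rightarrow> 'a measure) \<Rightarrow> nat \<Rightarrow> ereal" where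
  "ricci P k = (INF x. INF y. ricci_at P k x y)"


subsection \<open>Diffusion constant, local dimension, granularity\<close>

definition msupport :: "'a::topological_space measure \<Rightarrow> 'a set" where
  "msupport M = {x. \<forall>U. open U \<longrightarrow> x \<in> U \<longrightarrow> 0 < emeasure M U}"

definition diffusion :: "('a::metric_space \<Rightarrow> 'a measure) \<Rightarrow> 'a \<Rightarrow> ennreal" where
  "diffusion P x =
     ennreal_sqrt ((\<integral>\<^sup>+ z. (\<integral>\<^sup>+ y. ennreal ((dist y z)\<^sup>2) \<partial>P x) \<partial>P x) / 2)"

text \<open>
  The variance of a function given on the support of \<^term>\<open>M\<close> only: all integrals are
  restricted to the support, so the values of \<^term>\<open>f\<close> elsewhere are irrelevant. It is
  infinite when \<^term>\<open>f\<close> is not square integrable.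
\<close>

definition support_variance :: "'a::topological_space measure \<Rightarrow> ('a \<Rightarrow> real) \<Rightarrow> ennreal" where
  "support_variance M f =
     (\<integral>\<^sup>+ y \<in> msupport M. ennreal ((f y - (LINT z:msupport M|M. f z))\<^sup>2) \<partial>M)"

definition max_variance :: "'a::metric_space measure \<Rightarrow> ennreal" where
  "max_variance M =
     (SUP f\<in>{f :: 'a \<Rightarrow> real. 1-lipschitz_on (msupport M) f}. support_variance M f)"

definition local_dim :: "('a::metric_space \<Rightarrow> 'a measure) \<Rightarrow> 'a \<Rightarrow> ennreal" where
  "local_dim P x = (diffusion P x)\<^sup>2 / max_variance (P x)"

text \<open>
  When the diffusion constant vanishes, the quotient below is \<open>0 / (0 / 0) = 0\<close> in
  \<^typ>\<open>ennreal\<close>; the lemma \<open>diffusion_sq_div_local_dim\<close> below shows that this is the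
  intended value, namely the maximal variance of 1-Lipschitz functions, as in every other case
  with finite diffusion constant (in particular whenever the granularity is finite).
\<close>

definition S_max :: "('a::metric_space \<Rightarrow> 'a measure) \<Rightarrow> ennreal" where
  "S_max P = (SUP x. (diffusion P x)\<^sup>2 / local_dim P x)"

definition ediam :: "'a::metric_space set \<Rightarrow> ennreal" where
  "ediam S = (SUP y\<in>S. SUP z\<in>S. ennreal (dist y z))"

definition granularity :: "('a::metric_space \<Rightarrow> 'a measure) \<Rightarrow> ennreal" where
  "granularity P = (SUP x. ediam (msupport (P x)) / 2)"


subsection \<open>The variance proxy and the threshold\<close>

definition lip_coeff :: "('a::metric_space \<Rightarrow> real) \<Rightarrow> real" where
  "lip_coeff f = Inf {C. C-lipschitz_on UNIV f}"

definition D_max :: "('a::metric_space \<Rightarrow> 'a measure) \<Rightarrow> ('a \<Rightarrow> real) \<Rightarrow> ennreal" where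
  "D_max P f = 2 * (ennreal (lip_coeff f))\<^sup>2 * S_max P *
     (\<Sum>i. ereal_exp (ereal (2 / 3) * (1 - ricci P i) * ereal (lip_coeff f))
            * (e2ennreal (1 - ricci P i))\<^sup>2)"

definition t_max :: "('a::metric_space \<Rightarrow> 'a measure) \<Rightarrow> ('a \<Rightarrow> real) \<Rightarrow> real" where
  "t_max P f = enn2real (D_max P f) / (6 * enn2real (granularity P))"


subsection \<open>The quotient of squared diffusion constant and local dimension\<close>

lemma diffusion_sq:
  "(diffusion P x)\<^sup>2 = (\<integral>\<^sup>+ z. (\<integral>\<^sup>+ y. ennreal ((dist y z)\<^sup>2) \<partial>P x) \<partial>P x) / 2"
proof -
  have "(ennreal_sqrt a)\<^sup>2 = a" for a
    by (cases a) (auto simp: ennreal_sqrt_def ennreal_power power2_eq_square ennreal_top_mult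
        simp flip: ennreal_mult)
  then show ?thesis by (simp add: diffusion_def)
qed

lemma closed_msupport: "closed (msupport M)"
proof -
  have "- msupport M = \<Union>{U. open U \<and> emeasure M U = 0}"
    by (auto simp: msupport_def zero_less_iff_neq_zero)
  then show ?thesis by (auto simp: closed_def)
qed

lemma max_variance_eq_0:
  fixes P :: "'a::polish_space \<Rightarrow> 'a measure"
  assumes P: "markov_kernel P" and 0: "diffusion P x = 0"
  shows "max_variance (P x) = 0"
proof -
  have "P x \<in> space (prob_algebra borel)"
    using P unfolding markov_kernel_def by (rule measurable_space) simp
  then have sets[measurable_cong]: "sets (P x) = sets borel" and "prob_space (P x)"
    by (auto simp: space_prob_algebra)
  then interpret prob_space "P x" by simp
  have "(\<integral>\<^sup>+ z. (\<integral>\<^sup>+ y. ennreal ((dist y z)\<^sup>2) \<partial>P x) \<partial>P x) = 0"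
    using diffusion_sq[of P x] 0 by simp
  then have "AE z in P x. (\<integral>\<^sup>+ y. ennreal ((dist y z)\<^sup>2) \<partial>P x) = 0"
    by (subst (asm) nn_integral_0_iff_AE) measurable
  then obtain z where "(\<integral>\<^sup>+ y. ennreal ((dist y z)\<^sup>2) \<partial>P x) = 0"
    using AE_contr by fastforce
  then have "AE y in P x. ennreal ((dist y z)\<^sup>2) = 0"
    by (subst (asm) nn_integral_0_iff_AE) measurable
  then have z: "AE y in P x. y = z"
    by eventually_elim (simp add: ennreal_eq_0_iff)
  have "0 < emeasure (P x) U" if "open U" "z \<in> U" for U
  proof -
    have "AE y in P x. y \<in> U"
      using z by eventually_elim (use that in simp)
    then have "emeasure (P x) U = 1"
      using that sets by (intro emeasure_eq_1_AE) auto
    then show ?thesis by simp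
  qed
  then have zS: "z \<in> msupport (P x)" by (simp add: msupport_def)
  have "support_variance (P x) f = 0" if f: "1-lipschitz_on (msupport (P x)) f" for f
  proof -
    have [measurable]: "(\<lambda>y. indicator (msupport (P x)) y *\<^sub>R f y) \<in> borel_measurable (P x)"
      using borel_measurable_continuous_on_indicator[OF borel_closed[OF closed_msupport]
          lipschitz_on_continuous_on[OF f]]
      by (simp add: measurable_cong_sets[OF sets refl])
    have "AE y in P x. indicator (msupport (P x)) y *\<^sub>R f y = f z"
      using z by eventually_elim (use zS in simp)
    then have "(LINT y:msupport (P x)|P x. f y) = (LINT y|P x. f z)"
      unfolding set_lebesgue_integral_def by (intro integral_cong_AE) measurable
    then have m: "(LINT y:msupport (P x)|P x. f y) = f z"
      by (simp add: prob_space)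
    have "support_variance (P x) f = (\<integral>\<^sup>+ y. 0 \<partial>P x)"
      unfolding support_variance_def m
      by (rule nn_integral_cong_AE) (use z in \<open>eventually_elim, simp\<close>)
    then show ?thesis by simp
  qed
  then show ?thesis by (auto simp: max_variance_def SUP_eq_const bot_ennreal intro!: antisym SUP_least)
qed

lemma diffusion_sq_div_local_dim:
  fixes P :: "'a::polish_space \<Rightarrow> 'a measure"
  assumes "markov_kernel P" and "diffusion P x < \<top>"
  shows "(diffusion P x)\<^sup>2 / local_dim P x = max_variance (P x)"
proof (cases "diffusion P x = 0")
  case True
  then show ?thesis using max_variance_eq_0[OF assms(1)] by (simp add: local_dim_def)
next
  case False
  have "a / (a / b) = b" if "0 < a" "a < \<top>" for a b :: ennreal
  proof (cases "b = 0 \<or> b = \<top>")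
    case True
    then show ?thesis using that by (auto simp: ennreal_divide_zero)
  next
    case False
    with that show ?thesis
      by (cases a; cases b) (auto simp: divide_ennreal ennreal_less_zero_iff zero_less_iff_neq_zero)
  qed
  then show ?thesis using False assms(2)
    by (simp add: local_dim_def zero_less_iff_neq_zero power_less_top_ennreal)
qed

end

(*
  Put f_i = P^i f, which is Lipschitz with coefficient (1 - kappa_i) |f|_Lip. A second-order Taylor
  bound on the support of P_x, whose diameter is at most 2 sigma_infinity, gives for
  |l| <= 1 / (3 sigma_infinity)
    P (exp (l f_i)) <= exp (l f_(i+1) + l^2/2 |f|_Lip^2 S_max exp (2/3 (1 - kappa_i) |f|_Lip) (1 - kappa_i)^2).
  Integrating against pi, which P preserves, and iterating over i telescopes to
  E_pi exp (l (f - E_pi f)) <= exp (l^2 D_max / 4), because summability forces 1 - kappa_i to 0, so that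
  f_i tends to the constant E_pi f. Boundedness of f makes all these integrals finite, and truncation
  reduces to that case: the bounds are uniform enough to show that f is pi-integrable. The two regimes of the tail estimate come
  from l = 2 t / D_max and l = 1 / (3 sigma_infinity).
*)

theory Submission
  imports Defs
begin

section \<open>Elementary inequalities and facts about probability measures\<close>

text \<open>Taylor expansion of order two: the intermediate point of the Lagrange remainder is at
  most \<open>c\<close>, so the factor \<open>exp c\<close> covers it.\<close>

lemma exp_le_quadratic:
  fixes u c :: real
  assumes "\<bar>u\<bar> \<le> c"
  shows "exp u \<le> 1 + u + u\<^sup>2 / 2 * exp c"
proof -
  obtain t where t: "\<bar>t\<bar> \<le> \<bar>u\<bar>" "exp u = (\<Sum>m<2. u ^ m / fact m) + exp t / fact 2 * u ^ 2"
    using Maclaurin_exp_le[of u 2] by blast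
  have "exp t \<le> exp c" using t(1) assms by simp
  then have "exp t * u\<^sup>2 \<le> exp c * u\<^sup>2" by (intro mult_right_mono) auto
  then show ?thesis using t(2) by (simp add: numeral_2_eq_2 field_simps)
qed

text \<open>The complement of the support is the union of all open null sets. In a second countable
  space, Lindelof reduces this union to a countable one, which is null.\<close>

lemma AE_msupport:
  fixes M :: "'a::second_countable_topology measure"
  assumes "sets M = sets borel"
  shows "AE x in M. x \<in> msupport M"
proof -
  define \<F> where "\<F> = {U. open U \<and> emeasure M U = 0}"
  obtain \<F>' where F': "\<F>' \<subseteq> \<F>" "countable \<F>'" "\<Union>\<F>' = \<Union>\<F>"
    using Lindelof[of \<F>] by (auto simp: \<F>_def)
  have "\<Union>\<F>' \<in> null_sets M"
    using F'(1,2) assms by (intro null_sets_UN'[of \<F>' "\<lambda>x. x", simplified])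
      (auto simp: \<F>_def null_sets_def)
  moreover have "- msupport M = \<Union>\<F>"
    by (auto simp: msupport_def \<F>_def zero_less_iff_neq_zero)
  ultimately have "- msupport M \<in> null_sets M" using F'(3) by simp
  then show ?thesis by (auto dest: AE_not_in)
qed

lemma integrable_bounded_borel:
  fixes h :: "'a::topological_space \<Rightarrow> real"
  assumes "prob_space M" "sets M = sets borel" "h \<in> borel_measurable borel" "\<And>x. \<bar>h x\<bar> \<le> B"
  shows "integrable M h"
proof -
  interpret prob_space M by fact
  show ?thesis
    using assms by (intro integrable_const_bound[where B=B])
      (auto simp: measurable_cong_sets[OF assms(2) refl])
qed

lemma (in prob_space) abs_expectation_le:
  fixes h :: "'a \<Rightarrow> real"
  assumes "\<And>x. \<bar>h x\<bar> \<le> B"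
  shows "\<bar>expectation h\<bar> \<le> B"
proof (cases "integrable M h")
  case True
  then have "expectation (\<lambda>x. \<bar>h x\<bar>) \<le> expectation (\<lambda>_. B)"
    using assms by (intro integral_mono) auto
  then show ?thesis
    by (intro order_trans[OF integral_abs_bound]) (simp add: prob_space)
\<comment> \<open>A non-integrable \<open>h\<close> has Bochner integral 0 by default, and
  \<open>B\<close> is nonnegative since it bounds an absolute value.\<close>
next
  case False
  then show ?thesis
    using order_trans[OF abs_ge_zero assms] by (simp add: not_integrable_integral_eq)
qed

text \<open>The easy half of Kantorovich-Rubinstein duality: under any coupling the difference of
  the integrals is the expectation of \<open>h (fst z) - h (snd z)\<close>, which the Lipschitz
  bound controls by the transport cost.\<close>

lemma lipschitz_integral_diff_le_W1:
  fixes h :: "'a::polish_space \<Rightarrow> real"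
  assumes prob: "prob_space \<mu>" "prob_space \<nu>"
    and sets: "sets \<mu> = sets borel" "sets \<nu> = sets borel"
    and lip: "L-lipschitz_on UNIV h" and bdd: "\<And>x. \<bar>h x\<bar> \<le> B"
  shows "ennreal \<bar>(\<integral>x. h x \<partial>\<mu>) - (\<integral>x. h x \<partial>\<nu>)\<bar> \<le> ennreal L * W1 \<mu> \<nu>"
proof -
  interpret \<mu>: prob_space \<mu> by fact
  interpret \<nu>: prob_space \<nu> by fact
  have h[measurable]: "h \<in> borel_measurable borel"
    using lipschitz_on_continuous_on[OF lip] by (rule borel_measurable_continuous_onI)
  have L: "0 \<le> L" using lip by (rule lipschitz_on_nonneg)
  have le: "ennreal \<bar>(\<integral>x. h x \<partial>\<mu>) - (\<integral>x. h x \<partial>\<nu>)\<bar>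
      \<le> ennreal L * (\<integral>\<^sup>+ z. ennreal (dist (fst z) (snd z)) \<partial>Q)" if "Q \<in> couplings \<mu> \<nu>" for Q
  proof -
    have Q: "prob_space Q" "sets Q = sets (\<mu> \<Otimes>\<^sub>M \<nu>)" "distr Q \<mu> fst = \<mu>" "distr Q \<nu> snd = \<nu>"
      using that by (auto simp: couplings_def)
    interpret prob_space Q by fact
    have [measurable_cong]: "sets Q = sets (borel \<Otimes>\<^sub>M borel)"
      using Q(2) sets_pair_measure_cong[OF sets] by simp
    have [measurable]: "fst \<in> Q \<rightarrow>\<^sub>M \<mu>" "snd \<in> Q \<rightarrow>\<^sub>M \<nu>"
      using sets by (simp_all add: measurable_cong_sets[OF refl sets(1)] measurable_cong_sets[OF refl sets(2)])
    have [measurable]: "h \<in> borel_measurable \<mu>" "h \<in> borel_measurable \<nu>"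
      by (simp_all add: measurable_cong_sets[OF sets(1) refl] measurable_cong_sets[OF sets(2) refl])
    have int: "integrable Q (\<lambda>z. h (fst z))" "integrable Q (\<lambda>z. h (snd z))"
      by (auto intro!: integrable_const_bound[where B=B] simp: bdd)
    have "(\<integral>x. h x \<partial>\<mu>) - (\<integral>x. h x \<partial>\<nu>) = (\<integral>z. h (fst z) \<partial>Q) - (\<integral>z. h (snd z) \<partial>Q)"
      by (subst Q(3)[symmetric], subst Q(4)[symmetric], simp add: integral_distr)
    also have "\<dots> = (\<integral>z. h (fst z) - h (snd z) \<partial>Q)"
      using int by simp
    finally have "\<bar>(\<integral>x. h x \<partial>\<mu>) - (\<integral>x. h x \<partial>\<nu>)\<bar> \<le> (\<integral>z. \<bar>h (fst z) - h (snd z)\<bar> \<partial>Q)"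
      using integral_abs_bound[of Q "\<lambda>z. h (fst z) - h (snd z)"] by simp
    then have "ennreal \<bar>(\<integral>x. h x \<partial>\<mu>) - (\<integral>x. h x \<partial>\<nu>)\<bar> \<le> ennreal (\<integral>z. \<bar>h (fst z) - h (snd z)\<bar> \<partial>Q)"
      by (rule ennreal_leI)
    also have "\<dots> = (\<integral>\<^sup>+z. ennreal \<bar>h (fst z) - h (snd z)\<bar> \<partial>Q)"
      using int by (intro nn_integral_eq_integral[symmetric]) auto
    also have "\<dots> \<le> (\<integral>\<^sup>+z. ennreal L * ennreal (dist (fst z) (snd z)) \<partial>Q)"
      using lipschitz_onD[OF lip] L
      by (intro nn_integral_mono) (auto simp: dist_real_def ennreal_mult[symmetric] intro!: ennreal_leI)
    also have "\<dots> = ennreal L * (\<integral>\<^sup>+z. ennreal (dist (fst z) (snd z)) \<partial>Q)"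
      by (intro nn_integral_cmult) measurable
    finally show ?thesis .
  qed
  \<comment> \<open>The distance may be infinite, and 0 times \<top> is 0, so for
    \<open>L = 0\<close> the left side must vanish by itself: \<open>h\<close> is constant.
    Otherwise division by \<open>L\<close> turns the bound for each coupling into a lower bound of
    the infimum.\<close>
  show ?thesis
  proof (cases "L = 0")
    case True
    define c where "c = h undefined"
    have "h = (\<lambda>_. c)"
      using lipschitz_onD[OF lip, of _ undefined] True by (auto simp: c_def)
    then show ?thesis
      using \<mu>.prob_space \<nu>.prob_space by simp
  next
    case False
    define a where "a = \<bar>(\<integral>x. h x \<partial>\<mu>) - (\<integral>x. h x \<partial>\<nu>)\<bar>"
    have "ennreal (a / L) \<le> q" if "ennreal a \<le> ennreal L * q" for q
      using that False L by (cases q) (auto simp: a_def ennreal_mult[symmetric] field_simps)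
    then have "ennreal (a / L) \<le> W1 \<mu> \<nu>"
      unfolding W1_def using le by (intro INF_greatest) (auto simp: a_def)
    then have "ennreal L * ennreal (a / L) \<le> ennreal L * W1 \<mu> \<nu>"
      by (intro mult_left_mono) auto
    then show ?thesis
      using False L by (simp add: ennreal_mult[symmetric] a_def)
  qed
qed

section \<open>Exponential moments after one step of the chain\<close>

text \<open>Around its mean, \<open>h\<close> deviates on the support by at most \<alpha> times the
  diameter, so the quadratic bound for exp applies with a uniform constant. Its linear term
  integrates to 0, and the quadratic one is controlled by the maximal variance.\<close>

lemma lipschitz_exp_moment_le:
  fixes h :: "'a::polish_space \<Rightarrow> real"
  assumes M: "prob_space M" "sets M = sets borel"
    and lip: "\<alpha>-lipschitz_on UNIV h" and bdd: "\<And>x. \<bar>h x\<bar> \<le> B"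
    and var: "max_variance M \<le> ennreal S" and S: "0 \<le> S"
    and diam: "ediam (msupport M) \<le> ennreal (2 * \<sigma>)" and \<sigma>: "0 \<le> \<sigma>" and l: "\<bar>l\<bar> * (3 * \<sigma>) \<le> 1"
  shows "(\<integral>x. exp (l * h x) \<partial>M) \<le> exp (l * (\<integral>x. h x \<partial>M) + l\<^sup>2 / 2 * exp (2/3 * \<alpha>) * \<alpha>\<^sup>2 * S)"
proof -
  interpret prob_space M by fact
  have h0[measurable]: "h \<in> borel_measurable borel"
    using lipschitz_on_continuous_on[OF lip] by (rule borel_measurable_continuous_onI)
  note [measurable_cong] = M(2)
  have \<alpha>: "0 \<le> \<alpha>" using lip by (rule lipschitz_on_nonneg)
  define m where "m = (\<integral>x. h x \<partial>M)"
  define T where "T = msupport M"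
  have [measurable]: "T \<in> sets borel" unfolding T_def by (intro borel_closed closed_msupport)
  have supp: "AE x in M. x \<in> T" unfolding T_def by (rule AE_msupport[OF M(2)])
  have int: "integrable M h" by (rule integrable_bounded_borel[OF M h0 bdd])
  have mb: "\<bar>m\<bar> \<le> B"
    unfolding m_def by (rule abs_expectation_le) (rule bdd)
  have hmb: "\<bar>h x - m\<bar> \<le> 2 * B" for x using bdd[of x] mb by linarith
  have dist_le: "dist x y \<le> 2 * \<sigma>" if "x \<in> T" "y \<in> T" for x y
  proof -
    have "ennreal (dist x y) \<le> ediam T"
      unfolding ediam_def using that by (intro SUP_upper2[OF that(1)] SUP_upper2[OF that(2)]) auto
    also have "\<dots> \<le> ennreal (2 * \<sigma>)" using diam by (simp add: T_def)
    finally show ?thesis using \<sigma> by simp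
  qed
  \<comment> \<open>The mean averages \<open>h\<close> over the support, so the deviation at
    \<open>x\<close> is at most the average of \<open>\<bar>h x - h y\<bar>\<close> over
    \<open>y\<close>.\<close>
  have dev: "\<bar>h x - m\<bar> \<le> \<alpha> * (2 * \<sigma>)" if x: "x \<in> T" for x
  proof -
    have "AE y in M. \<bar>h x - h y\<bar> \<le> \<alpha> * (2 * \<sigma>)"
      using supp
    proof eventually_elim
      case (elim y)
      have "\<bar>h x - h y\<bar> \<le> \<alpha> * dist x y"
        using lipschitz_onD[OF lip, of x y] by (simp add: dist_real_def)
      also have "\<dots> \<le> \<alpha> * (2 * \<sigma>)" using dist_le[OF x elim] \<alpha> by (rule mult_left_mono)
      finally show ?case .
    qed
    then have "(\<integral>y. \<bar>h x - h y\<bar> \<partial>M) \<le> (\<integral>y. \<alpha> * (2 * \<sigma>) \<partial>M)"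
      using int by (intro integral_mono_AE) auto
    moreover have "h x - m = (\<integral>y. h x - h y \<partial>M)"
      using int by (simp add: m_def prob_space)
    ultimately have "\<bar>h x - m\<bar> \<le> (\<integral>y. \<alpha> * (2 * \<sigma>) \<partial>M)"
      using order_trans[OF integral_abs_bound] by metis
    then show ?thesis by (simp add: prob_space)
  qed
  have intsq: "integrable M (\<lambda>x. (h x - m)\<^sup>2)"
  proof (rule integrable_bounded_borel[OF M])
    show "\<bar>(h x - m)\<^sup>2\<bar> \<le> (2 * B)\<^sup>2" for x
      using power_mono[OF hmb, where n=2] by simp
  qed measurable
  have variance: "(\<integral>x. (h x - m)\<^sup>2 \<partial>M) \<le> \<alpha>\<^sup>2 * S"
  \<comment> \<open>For \<alpha> = 0 the deviation bound makes \<open>h\<close> constant on the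
    support. Otherwise \<open>h / \<alpha>\<close> is 1-Lipschitz and competes in
    \<open>max_variance\<close>.\<close>
  proof (cases "\<alpha> = 0")
    case True
    from supp have "AE x in M. (h x - m)\<^sup>2 = 0"
      by eventually_elim (use dev True in force)
    then have "(\<integral>x. (h x - m)\<^sup>2 \<partial>M) = 0" by (rule integral_eq_zero_AE)
    then show ?thesis using True by simp
  next
    case False
    then have \<alpha>0: "0 < \<alpha>" using \<alpha> by simp
    define g where "g x = h x / \<alpha>" for x
    have "1-lipschitz_on T g"
    proof (rule lipschitz_onI)
      show "dist (g x) (g y) \<le> 1 * dist x y" for x y
        using lipschitz_onD[OF lip, of x y] \<alpha>0
        by (simp add: g_def dist_real_def field_simps diff_divide_distrib[symmetric])
    qed simp
    then have "support_variance M g \<le> max_variance M"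
      unfolding max_variance_def T_def by (intro SUP_upper) auto
    then have sv: "support_variance M g \<le> ennreal S" using var by (rule order_trans)
    \<comment> \<open>The variance in \<open>max_variance\<close> is taken over the support only; as
      the support has full measure, the restriction changes neither the mean nor the
      variance.\<close>
    have mean: "(LINT x:T|M. g x) = m / \<alpha>"
    proof -
      have "(LINT x:T|M. g x) = (\<integral>x. g x \<partial>M)"
        unfolding set_lebesgue_integral_def
      proof (rule integral_cong_AE)
        show "AE x in M. indicat_real T x *\<^sub>R g x = g x"
          using supp by eventually_elim simp
      qed (simp_all add: g_def)
      then show ?thesis by (simp add: g_def m_def)
    qed
    have "support_variance M g = (\<integral>\<^sup>+x. ennreal ((h x - m)\<^sup>2 / \<alpha>\<^sup>2) \<partial>M)"
      unfolding support_variance_def T_def[symmetric] mean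
      by (rule nn_integral_cong_AE, use supp in eventually_elim)
        (auto simp: g_def diff_divide_distrib[symmetric] power_divide)
    also have "\<dots> = ennreal (\<integral>x. (h x - m)\<^sup>2 / \<alpha>\<^sup>2 \<partial>M)"
      using intsq by (intro nn_integral_eq_integral) auto
    finally have "(\<integral>x. (h x - m)\<^sup>2 \<partial>M) / \<alpha>\<^sup>2 \<le> S"
      using sv S by simp
    then show ?thesis using \<alpha>0 by (simp add: field_simps)
  qed
  define K where "K = exp (2/3 * \<alpha>)"
  have "AE x in M. exp (l * (h x - m)) \<le> 1 + l * (h x - m) + (l * (h x - m))\<^sup>2 / 2 * K"
    using supp
  proof eventually_elim
    case (elim x)
    have "\<bar>l * (h x - m)\<bar> \<le> \<bar>l\<bar> * (\<alpha> * (2 * \<sigma>))"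
      unfolding abs_mult using dev[OF elim] by (intro mult_left_mono) auto
    \<comment> \<open>The constant 2/3 is the ratio of the diameter bound
      \<open>2 * \<sigma>\<close> to the \<open>3 * \<sigma>\<close> in the restriction on
      \<open>l\<close>.\<close>
    also have "\<dots> = (2/3 * \<alpha>) * (\<bar>l\<bar> * (3 * \<sigma>))" by simp
    also have "\<dots> \<le> (2/3 * \<alpha>) * 1" using l \<alpha> by (intro mult_left_mono) auto
    finally show ?case unfolding K_def by (intro exp_le_quadratic) simp
  qed
  moreover have "integrable M (\<lambda>x. exp (l * (h x - m)))"
  proof (rule integrable_bounded_borel[OF M])
    show "\<bar>exp (l * (h x - m))\<bar> \<le> exp (\<bar>l\<bar> * (2 * B))" for x
    proof -
      have "l * (h x - m) \<le> \<bar>l\<bar> * \<bar>h x - m\<bar>" by (metis abs_ge_self abs_mult)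
      also have "\<dots> \<le> \<bar>l\<bar> * (2 * B)" using hmb by (intro mult_left_mono) auto
      finally show ?thesis by simp
    qed
  qed measurable
  ultimately have "(\<integral>x. exp (l * (h x - m)) \<partial>M)
      \<le> (\<integral>x. 1 + l * (h x - m) + (l * (h x - m))\<^sup>2 / 2 * K \<partial>M)"
    using int intsq by (intro integral_mono_AE) (auto simp: power_mult_distrib)
  also have "\<dots> = 1 + l\<^sup>2 / 2 * K * (\<integral>x. (h x - m)\<^sup>2 \<partial>M)"
    using int intsq by (simp add: power_mult_distrib prob_space m_def[symmetric])
  also have "\<dots> \<le> 1 + l\<^sup>2 / 2 * K * (\<alpha>\<^sup>2 * S)"
    using variance by (intro add_left_mono mult_left_mono) (auto simp: K_def)
  also have "\<dots> \<le> exp (l\<^sup>2 / 2 * K * (\<alpha>\<^sup>2 * S))" by (rule exp_ge_add_one_self)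
  finally have "(\<integral>x. exp (l * (h x - m)) \<partial>M) * exp (l * m) \<le> exp (l\<^sup>2 / 2 * K * (\<alpha>\<^sup>2 * S)) * exp (l * m)"
    by (intro mult_right_mono) auto
  moreover have "(\<integral>x. exp (l * h x) \<partial>M) = (\<integral>x. exp (l * (h x - m)) \<partial>M) * exp (l * m)"
    by (simp add: algebra_simps exp_diff)
  ultimately show ?thesis
    by (simp add: exp_add[symmetric] m_def K_def algebra_simps)
qed

section \<open>Iterated kernels\<close>

lemma measurable_kernel_pow:
  assumes "markov_kernel P"
  shows "kernel_pow P k \<in> borel \<rightarrow>\<^sub>M prob_algebra borel"
proof (induction k)
  case 0
  then show ?case using measurable_return_prob_space by (simp add: measurable_cong[OF kernel_pow.simps(1)])
next
  case (Suc k)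
  then show ?case
    using measurable_bind_prob_space[OF Suc assms[unfolded markov_kernel_def]]
    by (simp add: measurable_cong[OF kernel_pow.simps(2)])
qed

text \<open>The recursion defining \<open>kernel_pow\<close> adds the new step last. By
  associativity of bind it can equally come first, which is what lets \<open>iter h (Suc i)\<close>
  arise from \<open>iter h i\<close> by one application of \<open>P\<close>.\<close>

lemma kernel_pow_Suc_left:
  assumes "markov_kernel P"
  shows "kernel_pow P (Suc k) x = P x \<bind> kernel_pow P k"
proof (induction k)
  case 0
  have P: "P \<in> borel \<rightarrow>\<^sub>M subprob_algebra borel"
    using assms unfolding markov_kernel_def by (rule measurable_prob_algebraD)
  have "kernel_pow P 0 = return borel" by (rule ext) simp
  moreover have "sets (P x) = sets borel" using subprob_measurableD(2)[OF P] by simp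
  ultimately show ?case by (simp add: bind_return[OF P] bind_return'')
next
  case (Suc k)
  have P: "P \<in> borel \<rightarrow>\<^sub>M subprob_algebra borel"
    using assms unfolding markov_kernel_def by (rule measurable_prob_algebraD)
  have K: "kernel_pow P k \<in> P x \<rightarrow>\<^sub>M subprob_algebra borel"
    using measurable_prob_algebraD[OF measurable_kernel_pow[OF assms, of k]]
    by (simp add: subprob_measurableD[OF P])
  have "kernel_pow P (Suc (Suc k)) x = (P x \<bind> kernel_pow P k) \<bind> P"
    by (subst kernel_pow.simps(2)) (simp only: Suc)
  also have "\<dots> = P x \<bind> (\<lambda>y. kernel_pow P k y \<bind> P)"
    using K P by (rule bind_assoc)
  also have "(\<lambda>y. kernel_pow P k y \<bind> P) = kernel_pow P (Suc k)"
    by (rule ext) simp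
  finally show ?case .
qed

lemma integral_bind_kernel:
  fixes h :: "'a::topological_space \<Rightarrow> real"
  assumes "prob_space M" "sets M = sets borel" "K \<in> borel \<rightarrow>\<^sub>M prob_algebra borel"
    and "h \<in> borel_measurable borel" "\<And>x. \<bar>h x\<bar> \<le> B"
  shows "(\<integral>x. h x \<partial>(M \<bind> K)) = (\<integral>x. (\<integral>y. h y \<partial>K x) \<partial>M)"
proof (rule integral_bind[where K=borel and B=B and B'=1])
  interpret prob_space M by fact
  show K: "K \<in> M \<rightarrow>\<^sub>M subprob_algebra borel"
    using measurable_prob_algebraD[OF assms(3)] by (simp add: measurable_cong_sets[OF assms(2) refl])
  show "finite_measure M" by (rule finite_measure_axioms)
  show "AE x in M. emeasure (K x) (space (K x)) \<le> ennreal 1"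
    using subprob_space.subprob_emeasure_le_1[OF subprob_space_kernel[OF K]] by (intro AE_I2) auto
qed (use assms in auto)

section \<open>The chain with finite real constants, and bounded Lipschitz functions\<close>

text \<open>Here \<open>a i\<close> stands for 1 - \<kappa>_i, \<open>S\<close> for the supremum of
  the maximal variances and \<sigma> for the granularity. The curvature bound is multiplied out,
  which avoids division and extended reals.\<close>

locale curvature_chain =
  fixes P :: "'a::polish_space \<Rightarrow> 'a measure" and \<pi> :: "'a measure"
    and L \<sigma> S :: real and a :: "nat \<Rightarrow> real"
  assumes P: "markov_kernel P" and stat: "stationary P \<pi>"
    and \<sigma>_pos: "0 < \<sigma>" and L_nonneg: "0 \<le> L" and S_nonneg: "0 \<le> S" and a_nonneg: "\<And>i. 0 \<le> a i"
    and W1_le: "\<And>i x y. x \<noteq> y \<Longrightarrow> W1 (kernel_pow P i x) (kernel_pow P i y) \<le> ennreal (a i * dist x y)"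
    and variance_le: "\<And>x. max_variance (P x) \<le> ennreal S"
    and diam_le: "\<And>x. ediam (msupport (P x)) \<le> ennreal (2 * \<sigma>)"
    and summable_a: "summable (\<lambda>i. exp (2/3 * (L * a i)) * (a i)\<^sup>2)"
begin

definition "D = 2 * L\<^sup>2 * S * (\<Sum>i. exp (2/3 * (L * a i)) * (a i)\<^sup>2)"

lemma prob_\<pi>: "prob_space \<pi>" and sets_\<pi>[measurable_cong]: "sets \<pi> = sets borel"
  using stat by (auto simp: stationary_def space_prob_algebra)

sublocale prob_space \<pi> by (rule prob_\<pi>)

lemma prob_kernel_pow: "prob_space (kernel_pow P i x)"
  and sets_kernel_pow: "sets (kernel_pow P i x) = sets borel"
  using measurable_space[OF measurable_kernel_pow[OF P], of x i] by (auto simp: space_prob_algebra)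

lemma prob_P: "prob_space (P x)" and sets_P: "sets (P x) = sets borel"
  using measurable_space[OF P[unfolded markov_kernel_def], of x] by (auto simp: space_prob_algebra)

text \<open>Stationarity for functions: a step of the kernel may be inserted or removed under
  \<pi>.\<close>

lemma integral_P_\<pi>:
  fixes h :: "'a \<Rightarrow> real"
  assumes "h \<in> borel_measurable borel" "\<And>x. \<bar>h x\<bar> \<le> B"
  shows "(\<integral>x. (\<integral>y. h y \<partial>P x) \<partial>\<pi>) = (\<integral>x. h x \<partial>\<pi>)"
  using integral_bind_kernel[OF prob_\<pi> sets_\<pi> P[unfolded markov_kernel_def] assms] stat
  by (simp add: stationary_def)

definition iter :: "('a \<Rightarrow> real) \<Rightarrow> nat \<Rightarrow> 'a \<Rightarrow> real" where
  "iter h i x = (\<integral>y. h y \<partial>kernel_pow P i x)"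

text \<open>The terms of the convergent series tend to 0, and they dominate
  \<open>(a i)\<^sup>2\<close> because the exponential factor is at least 1.\<close>

lemma a_tendsto_0: "a \<longlonglongrightarrow> 0"
proof -
  have c0: "(\<lambda>i. exp (2/3 * (L * a i)) * (a i)\<^sup>2) \<longlonglongrightarrow> 0"
    using summable_a by (rule summable_LIMSEQ_zero)
  have "(\<lambda>i. (a i)\<^sup>2) \<longlonglongrightarrow> 0"
  proof (rule tendsto_sandwich[OF _ _ tendsto_const c0])
    show "\<forall>\<^sub>F i in sequentially. (a i)\<^sup>2 \<le> exp (2/3 * (L * a i)) * (a i)\<^sup>2"
      using a_nonneg L_nonneg by (intro always_eventually allI mult_le_cancel_right1[THEN iffD2]) auto
  qed auto
  then have "(\<lambda>i. sqrt ((a i)\<^sup>2)) \<longlonglongrightarrow> sqrt 0" by (rule tendsto_real_sqrt)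
  then show ?thesis using a_nonneg by simp
qed

context
  fixes h :: "'a \<Rightarrow> real" and B l :: real
  assumes lip: "L-lipschitz_on UNIV h" and bdd: "\<And>x. \<bar>h x\<bar> \<le> B"
begin

lemma borel_h[measurable]: "h \<in> borel_measurable borel"
  using lipschitz_on_continuous_on[OF lip] by (rule borel_measurable_continuous_onI)

lemma iter_0: "iter h 0 = h"
  by (rule ext) (simp add: iter_def integral_return)

lemma abs_iter_le: "\<bar>iter h i x\<bar> \<le> B"
  unfolding iter_def using bdd by (rule prob_space.abs_expectation_le[OF prob_kernel_pow])

lemma iter_Suc: "iter h (Suc i) x = (\<integral>y. iter h i y \<partial>P x)"
  unfolding iter_def kernel_pow_Suc_left[OF P]
  by (rule integral_bind_kernel[OF prob_P sets_P measurable_kernel_pow[OF P] borel_h bdd])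

text \<open>The curvature enters here: it contracts the distance between the laws after
  \<open>i\<close> steps, and the duality inequality transfers the contraction to functions.\<close>

lemma lipschitz_iter: "(L * a i)-lipschitz_on UNIV (iter h i)"
proof (rule lipschitz_onI)
  have L: "0 \<le> L" using lip by (rule lipschitz_on_nonneg)
  then show nn: "0 \<le> L * a i" using a_nonneg by simp
  show "dist (iter h i x) (iter h i y) \<le> L * a i * dist x y" for x y
  proof (cases "x = y")
    case False
    have "ennreal \<bar>iter h i x - iter h i y\<bar> \<le> ennreal L * W1 (kernel_pow P i x) (kernel_pow P i y)"
      unfolding iter_def by (intro lipschitz_integral_diff_le_W1[OF _ _ _ _ lip bdd] prob_kernel_pow sets_kernel_pow)
    also have "\<dots> \<le> ennreal L * ennreal (a i * dist x y)"
      using W1_le[OF False] by (intro mult_left_mono) auto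
    also have "\<dots> = ennreal (L * a i * dist x y)"
      using L by (simp add: ennreal_mult'[symmetric] mult.assoc)
    finally show ?thesis using nn by (simp add: dist_real_def ennreal_le_iff)
  qed simp
qed

lemma borel_iter[measurable]: "iter h i \<in> borel_measurable borel"
  using lipschitz_on_continuous_on[OF lipschitz_iter] by (rule borel_measurable_continuous_onI)

lemma integrable_iter: "integrable \<pi> (iter h i)"
  using prob_\<pi> sets_\<pi> borel_iter abs_iter_le by (rule integrable_bounded_borel)

lemma integral_iter: "(\<integral>x. iter h i x \<partial>\<pi>) = (\<integral>x. h x \<partial>\<pi>)"
proof (induction i)
  case (Suc i)
  then show ?case
    using integral_P_\<pi>[OF borel_iter abs_iter_le, of i] by (simp add: iter_Suc)
qed (simp add: iter_0)

text \<open>By stationarity \<open>iter h i x\<close> minus the mean is the \<pi>-average over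
  \<open>y\<close> of \<open>iter h i x - iter h i y\<close>. This tends to 0 pointwise as the
  Lipschitz constants do. The constant \<open>2 * B\<close> serves as the dominating function, so
  \<open>dist x y\<close> need not be integrable in \<open>y\<close>.\<close>

lemma iter_tendsto: "(\<lambda>i. iter h i x) \<longlonglongrightarrow> (\<integral>x. h x \<partial>\<pi>)"
proof -
  have "(\<lambda>i. \<integral>y. iter h i x - iter h i y \<partial>\<pi>) \<longlonglongrightarrow> (\<integral>y. 0 \<partial>\<pi>)"
  proof (rule integral_dominated_convergence[where w="\<lambda>_. 2 * B"])
    have "(\<lambda>i. iter h i x - iter h i y) \<longlonglongrightarrow> 0" for y
    proof (rule Lim_null_comparison)
      show "\<forall>\<^sub>F i in sequentially. norm (iter h i x - iter h i y) \<le> L * a i * dist x y"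
        using lipschitz_onD[OF lipschitz_iter, of x y] by (simp add: dist_real_def)
      have "(\<lambda>i. L * a i * dist x y) \<longlonglongrightarrow> L * 0 * dist x y"
        by (intro tendsto_intros a_tendsto_0)
      then show "(\<lambda>i. L * a i * dist x y) \<longlonglongrightarrow> 0" by simp
    qed
    then show "AE y in \<pi>. (\<lambda>i. iter h i x - iter h i y) \<longlonglongrightarrow> 0" by simp
    have "norm (iter h i x - iter h i y) \<le> 2 * B" for i y
      using abs_iter_le[of i x] abs_iter_le[of i y] by simp
    then show "AE y in \<pi>. norm (iter h i x - iter h i y) \<le> 2 * B" for i by simp
  qed auto
  then have "(\<lambda>i. iter h i x - (\<integral>x. h x \<partial>\<pi>)) \<longlonglongrightarrow> 0"
    using integrable_iter by (simp add: integral_iter prob_space)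
  then show ?thesis by (simp add: LIM_zero_iff)
qed

lemma abs_exp_iter_le: "\<bar>exp (l * iter h i x)\<bar> \<le> exp (\<bar>l\<bar> * B)"
proof -
  have "l * iter h i x \<le> \<bar>l\<bar> * \<bar>iter h i x\<bar>" by (metis abs_ge_self abs_mult)
  also have "\<dots> \<le> \<bar>l\<bar> * B" using abs_iter_le by (intro mult_left_mono) auto
  finally show ?thesis by simp
qed

lemma integrable_exp_iter: "integrable \<pi> (\<lambda>x. exp (l * iter h i x))"
  by (rule integrable_bounded_borel[OF prob_\<pi> sets_\<pi> _ abs_exp_iter_le]) measurable

text \<open>Stationarity inserts a step of \<open>P\<close> under the integral, and the one-step
  bound applies to \<open>iter h i\<close> with Lipschitz constant \<open>L * a i\<close>.\<close>

lemma integral_exp_iter_le: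
  assumes l: "\<bar>l\<bar> * (3 * \<sigma>) \<le> 1"
  shows "(\<integral>x. exp (l * iter h i x) \<partial>\<pi>)
    \<le> exp (l\<^sup>2 / 2 * L\<^sup>2 * S * (exp (2/3 * (L * a i)) * (a i)\<^sup>2)) * (\<integral>x. exp (l * iter h (Suc i) x) \<partial>\<pi>)"
proof -
  have "(\<integral>x. exp (l * iter h i x) \<partial>\<pi>) = (\<integral>x. (\<integral>y. exp (l * iter h i y) \<partial>P x) \<partial>\<pi>)"
    by (rule integral_P_\<pi>[symmetric, OF _ abs_exp_iter_le]) measurable
  also have "\<dots> \<le> (\<integral>x. exp (l\<^sup>2 / 2 * L\<^sup>2 * S * (exp (2/3 * (L * a i)) * (a i)\<^sup>2)) * exp (l * iter h (Suc i) x) \<partial>\<pi>)"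
  proof (rule integral_mono)
    show "integrable \<pi> (\<lambda>x. \<integral>y. exp (l * iter h i y) \<partial>P x)"
    proof (rule integrable_bounded_borel[OF prob_\<pi> sets_\<pi>])
      show "\<bar>\<integral>y. exp (l * iter h i y) \<partial>P x\<bar> \<le> exp (\<bar>l\<bar> * B)" for x
        by (rule prob_space.abs_expectation_le[OF prob_P abs_exp_iter_le])
      show "(\<lambda>x. \<integral>y. exp (l * iter h i y) \<partial>P x) \<in> borel_measurable borel"
        by (rule measurable_compose[OF measurable_prob_algebraD[OF P[unfolded markov_kernel_def]]
              integral_measurable_subprob_algebra]) measurable
    qed
    show "integrable \<pi> (\<lambda>x. exp (l\<^sup>2 / 2 * L\<^sup>2 * S * (exp (2/3 * (L * a i)) * (a i)\<^sup>2)) * exp (l * iter h (Suc i) x))"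
      by (intro integrable_mult_right integrable_exp_iter)
    show "(\<integral>y. exp (l * iter h i y) \<partial>P x)
        \<le> exp (l\<^sup>2 / 2 * L\<^sup>2 * S * (exp (2/3 * (L * a i)) * (a i)\<^sup>2)) * exp (l * iter h (Suc i) x)" for x
      using lipschitz_exp_moment_le[OF prob_P sets_P lipschitz_iter abs_iter_le variance_le S_nonneg diam_le _ l, of x i] \<sigma>_pos
      by (simp add: iter_Suc exp_add[symmetric] power_mult_distrib algebra_simps)
  qed
  finally show ?thesis by simp
qed

text \<open>After \<open>n\<close> steps the accumulated factor involves the partial sums of the
  series for \<open>D\<close>, while the remaining integral tends to that of a constant. Since
  \<open>D\<close> carries a factor 2, the exponent \<open>l\<^sup>2 / 2\<close> becomes
  \<open>l\<^sup>2 * D / 4\<close>.\<close>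

lemma integral_exp_le_bounded:
  assumes l: "\<bar>l\<bar> * (3 * \<sigma>) \<le> 1"
  shows "(\<integral>x. exp (l * h x) \<partial>\<pi>) \<le> exp (l * (\<integral>x. h x \<partial>\<pi>) + l\<^sup>2 * D / 4)"
proof -
  define c where "c i = exp (2/3 * (L * a i)) * (a i)\<^sup>2" for i
  have "(\<integral>x. exp (l * h x) \<partial>\<pi>)
      \<le> exp (l\<^sup>2 / 2 * L\<^sup>2 * S * (\<Sum>i<n. c i)) * (\<integral>x. exp (l * iter h n x) \<partial>\<pi>)" for n
  proof (induction n)
    case (Suc n)
    note Suc
    also have "exp (l\<^sup>2 / 2 * L\<^sup>2 * S * (\<Sum>i<n. c i)) * (\<integral>x. exp (l * iter h n x) \<partial>\<pi>)
      \<le> exp (l\<^sup>2 / 2 * L\<^sup>2 * S * (\<Sum>i<n. c i)) *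
         (exp (l\<^sup>2 / 2 * L\<^sup>2 * S * c n) * (\<integral>x. exp (l * iter h (Suc n) x) \<partial>\<pi>))"
      using integral_exp_iter_le[OF l] by (intro mult_left_mono) (auto simp: c_def)
    finally show ?case by (simp add: distrib_left exp_add mult.assoc)
  qed (simp add: iter_0)
  moreover have "exp (l\<^sup>2 / 2 * L\<^sup>2 * S * (\<Sum>i<n. c i)) * (\<integral>x. exp (l * iter h n x) \<partial>\<pi>)
      \<le> exp (l\<^sup>2 * D / 4) * (\<integral>x. exp (l * iter h n x) \<partial>\<pi>)" for n
  proof -
    have "(\<Sum>i<n. c i) \<le> (\<Sum>i. c i)"
      using summable_a by (intro sum_le_suminf) (auto simp: c_def)
    then have "l\<^sup>2 / 2 * L\<^sup>2 * S * (\<Sum>i<n. c i) \<le> l\<^sup>2 / 2 * L\<^sup>2 * S * (\<Sum>i. c i)"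
      using S_nonneg by (intro mult_left_mono) auto
    also have "\<dots> = l\<^sup>2 * D / 4" by (simp add: D_def c_def)
    finally show ?thesis by (intro mult_right_mono) auto
  qed
  ultimately have le: "(\<integral>x. exp (l * h x) \<partial>\<pi>) \<le> exp (l\<^sup>2 * D / 4) * (\<integral>x. exp (l * iter h n x) \<partial>\<pi>)" for n
    by (rule order_trans)
  have "(\<lambda>n. \<integral>x. exp (l * iter h n x) \<partial>\<pi>) \<longlonglongrightarrow> (\<integral>x. exp (l * (\<integral>x. h x \<partial>\<pi>)) \<partial>\<pi>)"
  proof (rule integral_dominated_convergence[where w="\<lambda>_. exp (\<bar>l\<bar> * B)"])
    show "AE x in \<pi>. (\<lambda>n. exp (l * iter h n x)) \<longlonglongrightarrow> exp (l * (\<integral>x. h x \<partial>\<pi>))"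
      by (intro AE_I2 tendsto_intros iter_tendsto)
    show "AE x in \<pi>. norm (exp (l * iter h n x)) \<le> exp (\<bar>l\<bar> * B)" for n
      using abs_exp_iter_le by (intro AE_I2) (simp only: real_norm_def)
  qed auto
  then have "(\<lambda>n. exp (l\<^sup>2 * D / 4) * (\<integral>x. exp (l * iter h n x) \<partial>\<pi>))
      \<longlonglongrightarrow> exp (l\<^sup>2 * D / 4) * exp (l * (\<integral>x. h x \<partial>\<pi>))"
    by (intro tendsto_intros) (simp add: prob_space)
  from LIMSEQ_le_const[OF this] le show ?thesis
    by (simp add: exp_add mult.commute)
qed

end

section \<open>Removal of the boundedness assumption by truncation\<close>

text \<open>Both claims rest on the same truncations. Monotone convergence gives exponential
  integrability at the largest admissible parameter; this makes the integral of \<open>f\<close> a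
  genuine mean and supplies the dominating function for the moment bound.\<close>

lemma
  assumes lip: "L-lipschitz_on UNIV f"
  shows integrable_exp_abs: "integrable \<pi> (\<lambda>x. exp (\<bar>f x\<bar> / (3 * \<sigma>)))"
    and integral_exp_le: "\<bar>l\<bar> * (3 * \<sigma>) \<le> 1 \<Longrightarrow>
      (\<integral>x. exp (l * (f x - (\<integral>x. f x \<partial>\<pi>))) \<partial>\<pi>) \<le> exp (l\<^sup>2 * D / 4)"
proof -
  have f[measurable]: "f \<in> borel_measurable borel"
    using lipschitz_on_continuous_on[OF lip] by (rule borel_measurable_continuous_onI)
  define l\<^sub>0 where "l\<^sub>0 = 1 / (3 * \<sigma>)"
  have l0: "0 < l\<^sub>0" "\<bar>l\<^sub>0\<bar> * (3 * \<sigma>) \<le> 1" "\<bar>- l\<^sub>0\<bar> * (3 * \<sigma>) \<le> 1"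
    using \<sigma>_pos by (auto simp: l\<^sub>0_def)
  define \<phi> where "\<phi> n x = max (- real n) (min (real n) (f x))" for n x
  have [measurable]: "\<phi> n \<in> borel_measurable borel" for n unfolding \<phi>_def by measurable
  have \<phi>_lip: "L-lipschitz_on UNIV (\<phi> n)" for n
  proof (rule lipschitz_onI)
    show "dist (\<phi> n x) (\<phi> n y) \<le> L * dist x y" for x y
      using lipschitz_onD[OF lip, of x y] by (simp add: \<phi>_def dist_real_def)
    show "0 \<le> L" using lip by (rule lipschitz_on_nonneg)
  qed
  have \<phi>_bdd: "\<bar>\<phi> n x\<bar> \<le> real n" for n x by (auto simp: \<phi>_def)
  have abs_\<phi>: "\<bar>\<phi> n x\<bar> = min (real n) \<bar>f x\<bar>" for n x by (auto simp: \<phi>_def)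
  have \<phi>_lim: "(\<lambda>n. \<phi> n x) \<longlonglongrightarrow> f x" for x
  proof (rule tendsto_eventually)
    obtain N :: nat where "\<bar>f x\<bar> \<le> real N" using real_arch_simple by blast
    then show "\<forall>\<^sub>F n in sequentially. \<phi> n x = f x"
      by (intro eventually_sequentiallyI[of N]) (auto simp: \<phi>_def)
  qed
  have int_\<phi>: "integrable \<pi> (\<lambda>x. exp (l * \<phi> n x))" for l n
    using integrable_exp_iter[OF \<phi>_lip \<phi>_bdd, of l n 0] by (simp add: iter_0[OF \<phi>_lip \<phi>_bdd])
  \<comment> \<open>The bound for \<open>l\<^sub>0\<close> and \<open>- l\<^sub>0\<close> controls the product of the two exponential moments of \<open>\<phi> n\<close>
    without reference to its mean, and \<open>b > 0\<close> bounds each factor from below uniformly in \<open>n\<close>.\<close>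
  define b where "b = (\<integral>x. exp (- (l\<^sub>0 * \<bar>f x\<bar>)) \<partial>\<pi>)"
  have int_b: "integrable \<pi> (\<lambda>x. exp (- (l\<^sub>0 * \<bar>f x\<bar>)))"
    using l0 by (intro integrable_bounded_borel[OF prob_\<pi> sets_\<pi>, where B=1]) auto
  have b_pos: "0 < b"
  proof -
    have "0 \<le> b" unfolding b_def by (rule integral_nonneg_AE) auto
    moreover have "b \<noteq> 0"
    proof
      assume "b = 0"
      then have "AE x in \<pi>. exp (- (l\<^sub>0 * \<bar>f x\<bar>)) = 0"
        unfolding b_def using int_b by (subst (asm) integral_nonneg_eq_0_iff_AE) auto
      then show False by simp
    qed
    ultimately show ?thesis by simp
  qed
  define C where "C = exp (l\<^sub>0\<^sup>2 * D / 2) / b"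
  have C: "(\<integral>x. exp (l * \<phi> n x) \<partial>\<pi>) \<le> C" if l: "l = l\<^sub>0 \<or> l = - l\<^sub>0" for l n
  proof -
    have b_le: "b \<le> (\<integral>x. exp (- l * \<phi> n x) \<partial>\<pi>)"
      unfolding b_def
    proof (rule integral_mono[OF int_b int_\<phi>])
      show "exp (- (l\<^sub>0 * \<bar>f x\<bar>)) \<le> exp (- l * \<phi> n x)" for x
      proof -
        have "l * \<phi> n x \<le> \<bar>l\<bar> * \<bar>\<phi> n x\<bar>" by (metis abs_ge_self abs_mult)
        also have "\<dots> = l\<^sub>0 * \<bar>\<phi> n x\<bar>" using l l0 by auto
        also have "\<dots> \<le> l\<^sub>0 * \<bar>f x\<bar>" using l0 by (intro mult_left_mono) (auto simp: abs_\<phi>)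
        finally show ?thesis by simp
      qed
    qed
    have "(\<integral>x. exp (l * \<phi> n x) \<partial>\<pi>) * b \<le> (\<integral>x. exp (l * \<phi> n x) \<partial>\<pi>) * (\<integral>x. exp (- l * \<phi> n x) \<partial>\<pi>)"
      using b_le by (intro mult_left_mono integral_nonneg_AE) auto
    also have "\<dots> \<le> exp (l * (\<integral>x. \<phi> n x \<partial>\<pi>) + l\<^sup>2 * D / 4) * exp (- l * (\<integral>x. \<phi> n x \<partial>\<pi>) + (- l)\<^sup>2 * D / 4)"
      using l l0 by (intro mult_mono integral_exp_le_bounded[OF \<phi>_lip \<phi>_bdd] integral_nonneg_AE) auto
    also have "\<dots> = exp (l\<^sub>0\<^sup>2 * D / 2)"
      unfolding exp_add[symmetric] using l by auto
    finally show ?thesis using b_pos by (simp add: C_def field_simps)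
  qed
  \<comment> \<open>The exponential of an absolute value is at most the sum of the exponentials for
    both signs, hence the factor 2.\<close>
  have C2: "(\<integral>\<^sup>+x. ennreal (exp (l\<^sub>0 * \<bar>\<phi> n x\<bar>)) \<partial>\<pi>) \<le> ennreal (2 * C)" for n
  proof -
    have "(\<integral>\<^sup>+x. ennreal (exp (l\<^sub>0 * \<bar>\<phi> n x\<bar>)) \<partial>\<pi>) \<le> (\<integral>\<^sup>+x. ennreal (exp (l\<^sub>0 * \<phi> n x) + exp (- l\<^sub>0 * \<phi> n x)) \<partial>\<pi>)"
      by (intro nn_integral_mono ennreal_leI) (auto simp: abs_if)
    also have "\<dots> = ennreal (\<integral>x. exp (l\<^sub>0 * \<phi> n x) + exp (- l\<^sub>0 * \<phi> n x) \<partial>\<pi>)"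
      using int_\<phi>[of "l\<^sub>0" n] int_\<phi>[of "- l\<^sub>0" n]
      by (intro nn_integral_eq_integral Bochner_Integration.integrable_add) auto
    also have "(\<integral>x. exp (l\<^sub>0 * \<phi> n x) + exp (- l\<^sub>0 * \<phi> n x) \<partial>\<pi>) \<le> 2 * C"
      using C[of l\<^sub>0 n] C[of "- l\<^sub>0" n] int_\<phi>[of "l\<^sub>0" n] int_\<phi>[of "- l\<^sub>0" n] by (subst Bochner_Integration.integral_add) auto
    finally show ?thesis by (simp add: ennreal_leI)
  qed
  \<comment> \<open>Monotone convergence applies because \<open>\<bar>\<phi> n x\<bar>\<close> is
    the minimum of \<open>n\<close> and \<open>\<bar>f x\<bar>\<close>, which increases with
    \<open>n\<close>.\<close>
  have "(\<lambda>n. \<integral>\<^sup>+x. ennreal (exp (l\<^sub>0 * \<bar>\<phi> n x\<bar>)) \<partial>\<pi>) \<longlonglongrightarrow> (\<integral>\<^sup>+x. ennreal (exp (l\<^sub>0 * \<bar>f x\<bar>)) \<partial>\<pi>)"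
  proof (rule nn_integral_LIMSEQ)
    show "incseq (\<lambda>n x. ennreal (exp (l\<^sub>0 * \<bar>\<phi> n x\<bar>)))"
      using l0 by (auto simp: incseq_def le_fun_def abs_\<phi> intro!: ennreal_leI)
    show "(\<lambda>n. ennreal (exp (l\<^sub>0 * \<bar>\<phi> n x\<bar>))) \<longlonglongrightarrow> ennreal (exp (l\<^sub>0 * \<bar>f x\<bar>))" for x
      by (intro tendsto_intros \<phi>_lim)
  qed auto
  then have "(\<integral>\<^sup>+x. ennreal (exp (l\<^sub>0 * \<bar>f x\<bar>)) \<partial>\<pi>) \<le> ennreal (2 * C)"
    using C2 by (intro LIMSEQ_le_const2) auto
  then have int_exp: "integrable \<pi> (\<lambda>x. exp (l\<^sub>0 * \<bar>f x\<bar>))"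
    by (intro integrableI_bounded) (auto intro: le_less_trans)
  then show "integrable \<pi> (\<lambda>x. exp (\<bar>f x\<bar> / (3 * \<sigma>)))" by (simp add: l\<^sub>0_def)
  have int_f: "integrable \<pi> f"
  proof (rule Bochner_Integration.integrable_bound)
    show "integrable \<pi> (\<lambda>x. exp (l\<^sub>0 * \<bar>f x\<bar>) / l\<^sub>0)" using int_exp by simp
    have "l\<^sub>0 * \<bar>f x\<bar> \<le> exp (l\<^sub>0 * \<bar>f x\<bar>)" for x
      using exp_ge_add_one_self[of "l\<^sub>0 * \<bar>f x\<bar>"] by linarith
    then show "AE x in \<pi>. norm (f x) \<le> norm (exp (l\<^sub>0 * \<bar>f x\<bar>) / l\<^sub>0)"
      using l0 by (simp add: field_simps)
  qed simp
  assume l: "\<bar>l\<bar> * (3 * \<sigma>) \<le> 1"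
  then have ll: "\<bar>l\<bar> \<le> l\<^sub>0" using \<sigma>_pos by (simp add: l\<^sub>0_def field_simps)
  have "(\<lambda>n. \<integral>x. \<phi> n x \<partial>\<pi>) \<longlonglongrightarrow> (\<integral>x. f x \<partial>\<pi>)"
    using int_f by (intro integral_dominated_convergence[where w="\<lambda>x. \<bar>f x\<bar>"])
      (auto simp: \<phi>_lim abs_\<phi>)
  then have lim1: "(\<lambda>n. exp (l * (\<integral>x. \<phi> n x \<partial>\<pi>) + l\<^sup>2 * D / 4)) \<longlonglongrightarrow> exp (l * (\<integral>x. f x \<partial>\<pi>) + l\<^sup>2 * D / 4)"
    by (intro tendsto_intros)
  have lim2: "(\<lambda>n. \<integral>x. exp (l * \<phi> n x) \<partial>\<pi>) \<longlonglongrightarrow> (\<integral>x. exp (l * f x) \<partial>\<pi>)"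
  proof (rule integral_dominated_convergence[where w="\<lambda>x. exp (l\<^sub>0 * \<bar>f x\<bar>)"])
    show "AE x in \<pi>. (\<lambda>n. exp (l * \<phi> n x)) \<longlonglongrightarrow> exp (l * f x)"
      by (intro AE_I2 tendsto_intros \<phi>_lim)
    have "l * \<phi> n x \<le> l\<^sub>0 * \<bar>f x\<bar>" for n x
    proof -
      have "l * \<phi> n x \<le> \<bar>l\<bar> * \<bar>\<phi> n x\<bar>" by (metis abs_ge_self abs_mult)
      also have "\<dots> \<le> l\<^sub>0 * \<bar>f x\<bar>" using ll by (intro mult_mono) (auto simp: abs_\<phi>)
      finally show ?thesis .
    qed
    then show "AE x in \<pi>. norm (exp (l * \<phi> n x)) \<le> exp (l\<^sub>0 * \<bar>f x\<bar>)" for n by simp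
  qed (use int_exp in auto)
  have "(\<integral>x. exp (l * f x) \<partial>\<pi>) \<le> exp (l * (\<integral>x. f x \<partial>\<pi>) + l\<^sup>2 * D / 4)"
    using integral_exp_le_bounded[OF \<phi>_lip \<phi>_bdd l] by (intro LIMSEQ_le[OF lim2 lim1]) auto
  then show "(\<integral>x. exp (l * (f x - (\<integral>x. f x \<partial>\<pi>))) \<partial>\<pi>) \<le> exp (l\<^sup>2 * D / 4)"
    by (simp add: right_diff_distrib exp_diff exp_add pos_divide_le_eq mult.commute)
qed

section \<open>The Chernoff bound\<close>

text \<open>Markov's inequality is applied to the exponential of
  \<open>l * \<bar>f x - E\<bar>\<close>, which is at most the sum of the exponentials for
  \<open>l\<close> and \<open>- l\<close>; the two moment bounds give the factor 2.\<close>

lemma tail_le: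
  assumes lip: "L-lipschitz_on UNIV f" and l: "0 \<le> l" "l * (3 * \<sigma>) \<le> 1"
  shows "measure \<pi> {x. t \<le> \<bar>f x - (\<integral>x. f x \<partial>\<pi>)\<bar>} \<le> 2 * exp (l\<^sup>2 * D / 4 - l * t)"
\<comment> \<open>For \<open>l = 0\<close> the bound is 2, while the rewriting of the event through
  exp requires positive \<open>l\<close>.\<close>
proof (cases "l = 0")
  case True
  then show ?thesis by (simp add: order_trans[OF prob_le_1])
next
  case False
  then have l0: "0 < l" using l by simp
  have f[measurable]: "f \<in> borel_measurable borel"
    using lipschitz_on_continuous_on[OF lip] by (rule borel_measurable_continuous_onI)
  define E where "E = (\<integral>x. f x \<partial>\<pi>)"
  have int: "integrable \<pi> (\<lambda>x. exp (k * (f x - E)))" if k: "\<bar>k\<bar> = l" for k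
  proof (rule Bochner_Integration.integrable_bound)
    show "integrable \<pi> (\<lambda>x. exp (\<bar>E\<bar> / (3 * \<sigma>)) * exp (\<bar>f x\<bar> / (3 * \<sigma>)))"
      by (intro integrable_mult_right integrable_exp_abs[OF lip])
    have "k * (f x - E) \<le> (\<bar>f x\<bar> + \<bar>E\<bar>) / (3 * \<sigma>)" for x
    proof -
      have "k * (f x - E) \<le> \<bar>k\<bar> * \<bar>f x - E\<bar>" by (metis abs_ge_self abs_mult)
      also have "\<dots> \<le> 1 / (3 * \<sigma>) * (\<bar>f x\<bar> + \<bar>E\<bar>)"
        using l k \<sigma>_pos by (intro mult_mono) (auto simp: field_simps)
      finally show ?thesis by simp
    qed
    then show "AE x in \<pi>. norm (exp (k * (f x - E))) \<le> norm (exp (\<bar>E\<bar> / (3 * \<sigma>)) * exp (\<bar>f x\<bar> / (3 * \<sigma>)))"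
      by (simp add: exp_add[symmetric] add_divide_distrib add.commute)
  qed measurable
  have intp: "integrable \<pi> (\<lambda>x. exp (l * (f x - E)))" "integrable \<pi> (\<lambda>x. exp (- l * (f x - E)))"
    using int[of l] int[of "- l"] l by auto
  have eq: "{x. t \<le> \<bar>f x - E\<bar>} = {x \<in> space \<pi>. exp (l * t) \<le> exp (l * \<bar>f x - E\<bar>)}"
    using l0 sets_eq_imp_space_eq[OF sets_\<pi>] by auto
  have le: "exp (l * \<bar>f x - E\<bar>) \<le> exp (l * (f x - E)) + exp (- l * (f x - E))" for x
    by (cases "E \<le> f x") (auto simp: algebra_simps)
  have inta: "integrable \<pi> (\<lambda>x. exp (l * \<bar>f x - E\<bar>))"
    by (rule Bochner_Integration.integrable_bound[OF Bochner_Integration.integrable_add[OF intp]])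
      (use le in \<open>auto simp: add_nonneg_nonneg\<close>)
  have "measure \<pi> {x. t \<le> \<bar>f x - E\<bar>} \<le> (\<integral>x. exp (l * \<bar>f x - E\<bar>) \<partial>\<pi>) / exp (l * t)"
    unfolding eq by (rule integral_Markov_inequality_measure[OF inta, where A="{}"]) auto
  also have "(\<integral>x. exp (l * \<bar>f x - E\<bar>) \<partial>\<pi>) \<le> (\<integral>x. exp (l * (f x - E)) + exp (- l * (f x - E)) \<partial>\<pi>)"
    using inta intp le by (intro integral_mono) auto
  also have "\<dots> = (\<integral>x. exp (l * (f x - E)) \<partial>\<pi>) + (\<integral>x. exp (- l * (f x - E)) \<partial>\<pi>)"
    using intp by (rule Bochner_Integration.integral_add)
  also have "\<dots> \<le> exp (l\<^sup>2 * D / 4) + exp ((- l)\<^sup>2 * D / 4)"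
    unfolding E_def using l by (intro add_mono integral_exp_le[OF lip]) auto
  finally show ?thesis
    by (simp add: divide_right_mono exp_diff E_def)
qed

end

section \<open>Passage from extended to real constants, and the two tail regimes\<close>

text \<open>The infimum is attained: every difference quotient is a lower bound of the set of
  Lipschitz constants.\<close>

lemma lipschitz_on_lip_coeff:
  assumes "\<exists>C. C-lipschitz_on UNIV f"
  shows "(lip_coeff f)-lipschitz_on UNIV f"
proof (rule lipschitz_onI)
  have ne: "{C. C-lipschitz_on UNIV f} \<noteq> {}" using assms by auto
  show "0 \<le> lip_coeff f"
    unfolding lip_coeff_def by (intro cInf_greatest[OF ne]) (auto dest: lipschitz_on_nonneg)
  show "dist (f x) (f y) \<le> lip_coeff f * dist x y" for x y
  proof (cases "x = y")
    case False
    have "dist (f x) (f y) / dist x y \<le> lip_coeff f"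
      unfolding lip_coeff_def using False
      by (intro cInf_greatest[OF ne]) (auto simp: field_simps dest: lipschitz_onD)
    then show ?thesis using False by (simp add: field_simps)
  qed simp
qed

text \<open>On the support, which has full measure, squared distances are bounded. The result
  supplies the finiteness under which \<open>diffusion_sq_div_local_dim\<close> identifies the
  quotient with the maximal variance.\<close>

lemma diffusion_less_top:
  fixes P :: "'a::polish_space \<Rightarrow> 'a measure"
  assumes P: "markov_kernel P" and diam: "ediam (msupport (P x)) \<le> ennreal d"
  shows "diffusion P x < \<top>"
proof -
  have "P x \<in> space (prob_algebra borel)"
    using P unfolding markov_kernel_def by (rule measurable_space) simp
  then have sets: "sets (P x) = sets borel" and "prob_space (P x)"
    by (auto simp: space_prob_algebra)
  then interpret prob_space "P x" by simp
  note supp = AE_msupport[OF sets]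
  have le: "ennreal ((dist y z)\<^sup>2) \<le> (ennreal d)\<^sup>2" if "y \<in> msupport (P x)" "z \<in> msupport (P x)" for y z
  proof -
    have "ennreal (dist y z) \<le> ediam (msupport (P x))"
      unfolding ediam_def using that by (intro SUP_upper2[OF that(1)] SUP_upper2[OF that(2)]) auto
    then have "(ennreal (dist y z))\<^sup>2 \<le> (ennreal d)\<^sup>2"
      using diam by (intro power_mono) auto
    then show ?thesis by (simp add: ennreal_power)
  qed
  have "(\<integral>\<^sup>+ z. (\<integral>\<^sup>+ y. ennreal ((dist y z)\<^sup>2) \<partial>P x) \<partial>P x) \<le> (\<integral>\<^sup>+ z. (ennreal d)\<^sup>2 \<partial>P x)"
  proof (rule nn_integral_mono_AE, use supp in eventually_elim)
    case (elim z)
    have "(\<integral>\<^sup>+ y. ennreal ((dist y z)\<^sup>2) \<partial>P x) \<le> (\<integral>\<^sup>+ y. (ennreal d)\<^sup>2 \<partial>P x)"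
      by (rule nn_integral_mono_AE, use supp in eventually_elim) (use le elim in auto)
    then show ?case by (simp add: emeasure_space_1)
  qed
  then have "(\<integral>\<^sup>+ z. (\<integral>\<^sup>+ y. ennreal ((dist y z)\<^sup>2) \<partial>P x) \<partial>P x) < \<top>"
    by (rule le_less_trans) (simp add: emeasure_space_1 power_less_top_ennreal)
  then have "(diffusion P x)\<^sup>2 < \<top>"
    by (simp add: diffusion_sq ennreal_divide_eq_top_iff less_top[symmetric])
  then show ?thesis by (simp add: power_less_top_ennreal)
qed

theorem theorem3p16:
  fixes P :: "'a::polish_space \<Rightarrow> 'a measure"
    and \<pi> :: "'a measure"
    and f :: "'a \<Rightarrow> real"
  assumes "markov_kernel P"
    and "stationary P \<pi>"
    and "\<And>x. W1 (return borel x) (P x) < \<top>"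
    and "\<exists>C. C-lipschitz_on UNIV f"
    and "0 < granularity P" and "granularity P < \<top>"
    and "0 < D_max P f" and "D_max P f < \<top>"
  shows "let D = enn2real (D_max P f); s = enn2real (granularity P); T = t_max P f;
             E = (\<integral>y. f y \<partial>\<pi>) in
           (\<forall>t. 0 \<le> t \<and> t \<le> T \<longrightarrow>
             measure \<pi> {x. \<bar>f x - E\<bar> \<ge> t} \<le> 2 * exp (- (t\<^sup>2 / D))) \<and>
           (\<forall>t. t > T \<longrightarrow>
             measure \<pi> {x. \<bar>f x - E\<bar> \<ge> t} \<le> 2 * exp (- (T\<^sup>2 / D) - (t - T) / (3 * s)))"
proof -
  define L where "L = lip_coeff f"
  define s where "s = enn2real (granularity P)"
  define S where "S = enn2real (S_max P)"
  define a where "a i = real_of_ereal (1 - ricci P i)" for i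
  define c where "c i = exp (2/3 * (L * a i)) * (a i)\<^sup>2" for i
  have lip: "L-lipschitz_on UNIV f" and L_nonneg: "0 \<le> L"
    using lipschitz_on_lip_coeff[OF assms(4)] lipschitz_on_nonneg by (auto simp: L_def)
  define \<Sigma> where "\<Sigma> = (\<Sum>i. ereal_exp (ereal (2 / 3) * (1 - ricci P i) * ereal L) * (e2ennreal (1 - ricci P i))\<^sup>2)"
  have D_eq: "D_max P f = 2 * (ennreal L)\<^sup>2 * S_max P * \<Sigma>"
    by (simp add: D_max_def \<Sigma>_def L_def)
  have "L \<noteq> 0" "S_max P \<noteq> 0" "\<Sigma> \<noteq> 0"
    using assms(7) by (auto simp: D_eq)
  then have L_pos: "0 < L" using L_nonneg by simp
  have "2 * (ennreal L)\<^sup>2 \<noteq> 0"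
    using L_pos by simp
  then have S_fin: "S_max P \<noteq> \<top>" and \<Sigma>_fin: "\<Sigma> \<noteq> \<top>"
    using assms(8) \<open>S_max P \<noteq> 0\<close> \<open>\<Sigma> \<noteq> 0\<close>
    by (auto simp: D_eq ennreal_mult_eq_top_iff ennreal_top_mult ennreal_mult_top less_top[symmetric])
  have S_max: "S_max P = ennreal S" using S_fin by (simp add: S_def less_top)
  have s_eq: "granularity P = ennreal s" using assms(6) by (simp add: s_def)
  have s_pos: "0 < s" using assms(5,6) by (simp add: s_def enn2real_positive_iff)
  \<comment> \<open>The convention that the curvature is 1 on the diagonal keeps the infimum at most
    1.\<close>
  have r_nonneg: "0 \<le> 1 - ricci P i" for i
  proof -
    have "ricci P i \<le> ricci_at P i undefined undefined"
      unfolding ricci_def by (intro INF_lower2[of undefined]) auto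
    then have "ricci P i \<le> 1" by (simp add: ricci_at_def)
    then show ?thesis by (simp add: ereal_diff_positive)
  qed
  \<comment> \<open>Infinite 1 - \<kappa>_i would make the corresponding summand of \<Sigma>
    infinite.\<close>
  have r_eq: "1 - ricci P i = ereal (a i)" for i
  proof -
    have "ereal_exp (ereal (2 / 3) * (1 - ricci P i) * ereal L) * (e2ennreal (1 - ricci P i))\<^sup>2 < \<top>"
      using \<Sigma>_fin[unfolded \<Sigma>_def less_top] by (rule ennreal_suminf_lessD)
    then have "1 - ricci P i \<noteq> \<infinity>"
      using L_pos by (auto simp: ereal_exp_def power2_eq_square)
    then show ?thesis using r_nonneg[of i] by (simp add: a_def ereal_real)
  qed
  have a_nonneg: "0 \<le> a i" for i using r_nonneg[of i] by (simp add: r_eq)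
  have \<Sigma>_c: "\<Sigma> = (\<Sum>i. ennreal (c i))"
    unfolding \<Sigma>_def r_eq
    by (simp add: ereal_exp_def c_def ennreal_mult ennreal_power a_nonneg mult_ac)
  have summable: "summable c"
    using \<Sigma>_fin a_nonneg unfolding \<Sigma>_c by (intro summable_suminf_not_top) (auto simp: c_def)
  have D_real: "enn2real (D_max P f) = 2 * L\<^sup>2 * S * (\<Sum>i. c i)"
  proof -
    have S_nonneg: "0 \<le> S" by (simp add: S_def)
    have sum_nonneg: "0 \<le> (\<Sum>i. c i)" using summable by (rule suminf_nonneg) (simp add: c_def)
    have "\<Sigma> = ennreal (\<Sum>i. c i)"
      using \<Sigma>_fin unfolding \<Sigma>_c by (intro suminf_ennreal) (auto simp: c_def)
    then show ?thesis
      by (simp add: D_eq S_max enn2real_mult power2_eq_square L_nonneg S_nonneg sum_nonneg)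
  qed
  have diam: "ediam (msupport (P x)) \<le> ennreal (2 * s)" for x
  proof -
    have "ediam (msupport (P x)) / 2 \<le> ennreal s"
      unfolding s_eq[symmetric] granularity_def by (rule SUP_upper) simp
    then show ?thesis
      using s_pos by (cases "ediam (msupport (P x))")
        (auto simp: divide_ennreal[of _ 2, simplified] ennreal_top_divide top_unique)
  qed
  interpret curvature_chain P \<pi> L s S a
  proof
    show "markov_kernel P" "stationary P \<pi>" by fact+
    show "0 < s" "0 \<le> L" "0 \<le> S" "0 \<le> a i" for i
      using s_pos L_nonneg a_nonneg by (auto simp: S_def)
    show "W1 (kernel_pow P i x) (kernel_pow P i y) \<le> ennreal (a i * dist x y)" if "x \<noteq> y" for i x y
    proof -
      have "ricci P i \<le> ricci_at P i x y"
        unfolding ricci_def by (intro INF_lower2[of x] INF_lower2[of y]) auto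
      moreover have "ricci P i = ereal (1 - a i)"
        using r_eq[of i] by (cases "ricci P i") (auto simp: one_ereal_def)
      \<comment> \<open>An infinite Wasserstein distance would make \<open>ricci_at\<close> minus
        infinity, contrary to the real lower bound \<open>1 - a i\<close>.\<close>
      ultimately show ?thesis
        using that a_nonneg[of i]
        by (cases "W1 (kernel_pow P i x) (kernel_pow P i y)")
          (auto simp: ricci_at_def field_simps one_ereal_def)
    qed
    show "max_variance (P x) \<le> ennreal S" for x
    proof -
      have "(diffusion P x)\<^sup>2 / local_dim P x \<le> S_max P"
        unfolding S_max_def by (rule SUP_upper) simp
      then show ?thesis
        using diffusion_sq_div_local_dim[OF assms(1) diffusion_less_top[OF assms(1) diam]]
        by (simp add: S_max)
    qed
    show "ediam (msupport (P x)) \<le> ennreal (2 * s)" for x by (rule diam)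
    show "summable (\<lambda>i. exp (2/3 * (L * a i)) * (a i)\<^sup>2)" using summable by (simp add: c_def[abs_def])
  qed
  have D: "enn2real (D_max P f) = D" by (simp add: D_real D_def c_def)
  have D_pos: "0 < D" unfolding D[symmetric] using assms(7,8) by (simp add: enn2real_positive_iff)
  define T where "T = t_max P f"
  have T: "T = D / (6 * s)" by (simp add: T_def t_max_def D s_def)
  have "measure \<pi> {x. t \<le> \<bar>f x - expectation f\<bar>} \<le> 2 * exp (- (t\<^sup>2 / D))" if t: "0 \<le> t" "t \<le> T" for t
  proof -
    \<comment> \<open>The parameter \<open>2 * t / D\<close> minimises
      \<open>l\<^sup>2 * D / 4 - l * t\<close> over \<open>l\<close>, and it is admissible exactly
      when \<open>t \<le> T\<close>.\<close>
    have l: "0 \<le> 2 * t / D" "2 * t / D * (3 * s) \<le> 1"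
      using t D_pos s_pos by (auto simp: T field_simps)
    have "(2 * t / D)\<^sup>2 * D / 4 - 2 * t / D * t = - (t\<^sup>2 / D)"
      using D_pos by (simp add: power2_eq_square field_simps)
    then show ?thesis
      using tail_le[OF lip l, of t] by (simp only:)
  qed
  moreover have "measure \<pi> {x. t \<le> \<bar>f x - expectation f\<bar>} \<le> 2 * exp (- (T\<^sup>2 / D) - (t - T) / (3 * s))" if "T < t" for t
  proof -
    \<comment> \<open>Beyond \<open>T\<close> the minimiser is no longer admissible, so the endpoint
      \<open>1 / (3 * s)\<close> is taken; it equals \<open>2 * T / D\<close>.\<close>
    have "(1 / (3 * s))\<^sup>2 * D / 4 - 1 / (3 * s) * t = - (T\<^sup>2 / D) - (t - T) / (3 * s)"
      using D_pos s_pos by (simp add: T power2_eq_square field_simps)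
    then show ?thesis
      using tail_le[OF lip, of "1 / (3 * s)" t] s_pos by simp
  qed
  ultimately show ?thesis
    by (simp add: Let_def D T_def[symmetric] s_def[symmetric])
qed

end
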